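(* Let $A\in\mathbb{C}^{n\times n}$, $B\in\mathbb{C}^{m\times n}$, $C\in\mathbb{C}^{n\times m}$, $D\in\mathbb{C}^{m\times m}$, with $S,s,Z,z,E,M_E$ as in the context. Suppose that at least one of the following conditions holds: (1) $M_E^\#$ exists, and $M_E^e=E$; (2) $s^\#$ exists, and $s^e=A^e$; (3) $z^\#$ exists, and $z^e=D^e$; (4) $A^\pi+s$ is invertible; (5) $I+A^d(s-A)$ is invertible (or $I+A^d(S-I)A$ is invertible); (6) $s^d=(I+A^d(s-A))^{-1}A^d$; (7) $D^\pi+z$ is invertible; (8) $I+D^d(z-D)$ is invertible (or $I+D^d(Z-I)D$ is invertible); (9) $z^d=(I+D^d(z-D))^{-1}D^d$; (10) $s^\#,z^\#$ exist, $s^\#=A^dCz^\#BA^d+A^d$, and $A^dCz^\#=s^\#CD^d$; (11) $s^\#,z^\#$ exist, $z^\#=D^dBs^\#CD^d+D^d$, and $D^dBs^\#=z^\#BA^d$; (12) $M_E^\#$ exists, and $M_E^\#=\begin{bmatrix}A^d+A^dCz^\#BA^d&-A^dCz^\#\\ -z^\#BA^d&z^\#\end{bmatrix}=\begin{bmatrix}s^\#&-s^\#CD^d\\ -D^dBs^\#&D^dBs^\#CD^d+D^d\end{bmatrix}$. If moreover $A^\pi CD^dB=0$, then $$S^d=s^\#+\sum_{i=0}^{k-1}(s^\#)^{i+2}SA^iA^\pi,$$ where $s^\#=A^dCz^\#BA^d+A^d$ and $k=\mathrm{ind}(A)$.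
   Context: All matrices are complex; $I$ is an identity matrix of the proper size. For a square matrix $X$: the Drazin inverse $X^d$ is the unique matrix with $XX^d=X^dX$, $X^dXX^d=X^d$, $X^k=X^{k+1}X^d$, where $k=\mathrm{ind}(X)$ is the smallest non-negative integer with $\mathrm{rank}(X^k)=\mathrm{rank}(X^{k+1})$ (it always exists). The group inverse $X^\#$, when it exists, is the unique matrix with $XX^\#X=X$, $X^\#XX^\#=X^\#$, $XX^\#=X^\#X$. Put $X^e=XX^d$, $X^\pi=I-X^e$, $X^0=I$. A sum whose upper limit is smaller than its lower limit is $0$. An equation containing a group inverse or an ordinary inverse includes the assertion that it exists. Notation: $S=A-CD^dB$, $s=A^eSA^e$, $Z=D-BA^dC$, $z=D^eZD^e$, $M=\begin{bmatrix}A&C\\ B&D\end{bmatrix}$, $E=\begin{bmatrix}A^e&0\\ 0&D^e\end{bmatrix}$, $M_E=EME=\begin{bmatrix}AA^e&A^eCD^e\\ D^eBA^e&DD^e\end{bmatrix}$. *)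

theory Defs
  imports "HOL-Analysis.Analysis"
begin

text \<open>
  An \<open>n\<close> by \<open>m\<close> matrix (\<open>n\<close> rows, \<open>m\<close> columns) has type \<open>complex ^ 'm ^ 'n\<close>.
  The class operation \<open>^\<close> on vectors and matrices is componentwise, so powers with respect
  to the matrix product \<open>**\<close> are introduced separately.
\<close>

primrec matrix_power :: "'a::semiring_1 ^ 'n ^ 'n \<Rightarrow> nat \<Rightarrow> 'a ^ 'n ^ 'n"  (infixr \<open>^\<^sub>m\<close> 80) where
  "X ^\<^sub>m 0 = mat 1"
| "X ^\<^sub>m Suc k = X ** (X ^\<^sub>m k)"

definition ind :: "complex ^ 'n ^ 'n \<Rightarrow> nat" where
  "ind X = (LEAST k. rank (X ^\<^sub>m k) = rank (X ^\<^sub>m (k + 1)))"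

definition is_drazin_inverse :: "complex ^ 'n ^ 'n \<Rightarrow> complex ^ 'n ^ 'n \<Rightarrow> bool" where
  "is_drazin_inverse X Y \<longleftrightarrow>
     X ** Y = Y ** X \<and> Y ** X ** Y = Y \<and> X ^\<^sub>m ind X = X ^\<^sub>m (ind X + 1) ** Y"

definition drazin_inverse :: "complex ^ 'n ^ 'n \<Rightarrow> complex ^ 'n ^ 'n"  (\<open>_\<^sup>d\<close> [1000] 1000) where
  "X\<^sup>d = (THE Y. is_drazin_inverse X Y)"

definition is_group_inverse :: "complex ^ 'n ^ 'n \<Rightarrow> complex ^ 'n ^ 'n \<Rightarrow> bool" where
  "is_group_inverse X Y \<longleftrightarrow> X ** Y ** X = X \<and> Y ** X ** Y = Y \<and> X ** Y = Y ** X"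

definition group_invertible :: "complex ^ 'n ^ 'n \<Rightarrow> bool" where
  "group_invertible X \<longleftrightarrow> (\<exists>Y. is_group_inverse X Y)"

text \<open>\<open>X\<^sup>#\<close> is meaningful only under \<open>group_invertible X\<close>.\<close>

definition group_inverse :: "complex ^ 'n ^ 'n \<Rightarrow> complex ^ 'n ^ 'n"  (\<open>_\<^sup>#\<close> [1000] 1000) where
  "X\<^sup># = (THE Y. is_group_inverse X Y)"

definition drazin_idem :: "complex ^ 'n ^ 'n \<Rightarrow> complex ^ 'n ^ 'n"  (\<open>_\<^sup>e\<close> [1000] 1000) where
  "X\<^sup>e = X ** X\<^sup>d"

definition spectral_idem :: "complex ^ 'n ^ 'n \<Rightarrow> complex ^ 'n ^ 'n"  (\<open>_\<^sup>\<pi>\<close> [1000] 1000) where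
  "X\<^sup>\<pi> = mat 1 - X\<^sup>e"

text \<open>\<open>block_matrix P Q R T\<close> has first block row \<open>P, Q\<close> and second block row \<open>R, T\<close>.\<close>

definition block_matrix ::
  "'a ^ 'c ^ 'r \<Rightarrow> 'a ^ 'd ^ 'r \<Rightarrow> 'a ^ 'c ^ 'q \<Rightarrow> 'a ^ 'd ^ 'q \<Rightarrow> 'a ^ ('c + 'd) ^ ('r + 'q)" where
  "block_matrix P Q R T =
     (\<chi> i j. case i of
        Inl i1 \<Rightarrow> (case j of Inl j1 \<Rightarrow> P $ i1 $ j1 | Inr j2 \<Rightarrow> Q $ i1 $ j2)
      | Inr i2 \<Rightarrow> (case j of Inl j1 \<Rightarrow> R $ i2 $ j1 | Inr j2 \<Rightarrow> T $ i2 $ j2))"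

end

theory Submission
  imports Defs
begin

text \<open>
  Each of the twelve conditions implies that \<open>s\<close>, \<open>z\<close> or \<open>M_E\<close> is invertible in the corner ring
  of the idempotent \<open>A\<^sup>e\<close>, \<open>D\<^sup>e\<close> or \<open>E\<close>, respectively. Compressed to these corners, \<open>A\<close>
  and \<open>D\<close> are invertible with inverses \<open>A\<^sup>d\<close> and \<open>D\<^sup>d\<close>, and \<open>s\<close> and \<open>z\<close> are the two Schur
  complements of \<open>M_E\<close>; so all three are invertible as soon as one is, and the formula for \<open>s\<^sup>#\<close> is the
  Banachiewicz--Schur formula. The hypothesis \<open>A\<^sup>\<pi> ** C ** D\<^sup>d ** B = 0\<close> means
  \<open>A\<^sup>\<pi> ** S = A\<^sup>\<pi> ** A\<close>, which makes \<open>S\<close> block triangular with respect to \<open>A\<^sup>e\<close>, with an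
  invertible diagonal block and the nilpotent diagonal block \<open>A ** A\<^sup>\<pi>\<close>.
\<close>

subsection \<open>Matrix algebra\<close>

lemma matrix_add_rdistrib: "(A + B) ** C = A ** C + B ** C"
  for C :: "'a::semiring_1 ^ 'n ^ 'm"
  by (vector matrix_matrix_mult_def distrib_right sum.distrib)

lemma matrix_diff_ldistrib: "A ** (B - C) = A ** B - A ** C"
  for A :: "'a::ring_1 ^ 'n ^ 'm"
  by (vector matrix_matrix_mult_def right_diff_distrib sum_subtractf)

lemma matrix_diff_rdistrib: "(A - B) ** C = A ** C - B ** C"
  for C :: "'a::ring_1 ^ 'n ^ 'm"
  by (vector matrix_matrix_mult_def left_diff_distrib sum_subtractf)

lemma matrix_sum_ldistrib: "A ** sum f I = (\<Sum>i\<in>I. A ** f i)"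
  for A :: "'a::ring_1 ^ 'n ^ 'm"
  by (induction I rule: infinite_finite_induct) (auto simp: matrix_add_ldistrib)

lemma matrix_sum_rdistrib: "sum f I ** A = (\<Sum>i\<in>I. f i ** A)"
  for A :: "'a::ring_1 ^ 'n ^ 'm"
  by (induction I rule: infinite_finite_induct) (auto simp: matrix_add_rdistrib)

lemmas matrix_ring_simps =
  matrix_mul_assoc[symmetric] matrix_add_ldistrib matrix_add_rdistrib
  matrix_diff_ldistrib matrix_diff_rdistrib

text \<open>Turns an equation between products into a rewrite rule for right-associated products.\<close>

lemma matrix_mult_collapse: "X ** Y = W \<Longrightarrow> X ** (Y ** V) = W ** V"
  by (simp add: matrix_mul_assoc)

lemma matrix_power_add: "X ^\<^sub>m (i + j) = (X ^\<^sub>m i) ** (X ^\<^sub>m j)"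
  by (induction i) (auto simp: matrix_mul_assoc)

lemma matrix_power_commute:
  assumes "X ** Y = Y ** X"
  shows "X ** (Y ^\<^sub>m k) = (Y ^\<^sub>m k) ** X"
proof (induction k)
  case (Suc k)
  have "X ** (Y ^\<^sub>m Suc k) = Y ** (X ** (Y ^\<^sub>m k))"
    using assms by (simp add: matrix_mul_assoc)
  with Suc show ?case
    by (simp add: matrix_mul_assoc)
qed simp

lemma matrix_power_Suc_right: "X ^\<^sub>m Suc k = (X ^\<^sub>m k) ** X"
  using matrix_power_commute[of X X k] by simp

lemma transpose_matrix_power: "transpose (X ^\<^sub>m k) = transpose X ^\<^sub>m k"
  for X :: "'a::comm_ring_1 ^ 'n ^ 'n"
proof (induction k)
  case (Suc k)
  then show ?case
    unfolding matrix_power_Suc_right[of X] by (simp add: matrix_transpose_mul)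
qed simp

section \<open>Row spaces and rank\<close>

lemma row_matrix_mult: "row i (X ** Y) = row i X v* Y"
  for Y :: "'a::comm_ring_1 ^ 'n ^ 'm"
  by (vector row_def matrix_matrix_mult_def vector_matrix_mult_def mult.commute)

lemma span_rows_eq: "vec.span (rows Y) = range (\<lambda>x. x v* Y)"
  for Y :: "'a::field ^ 'n ^ 'm"
proof
  have "vec.subspace (range (\<lambda>x. transpose Y *v x))"
    by (intro vec.subspace_image matrix_vector_mul_linear_gen vec.subspace_UNIV)
  then have "vec.subspace (range (\<lambda>x. x v* Y))"
    by simp
  moreover have "rows Y \<subseteq> range (\<lambda>x. x v* Y)"
    using row_matrix_mult[of _ "mat 1" Y] by (auto simp: rows_def)
  ultimately show "vec.span (rows Y) \<subseteq> range (\<lambda>x. x v* Y)"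
    by (rule vec.span_minimal[rotated])
next
  show "range (\<lambda>x. x v* Y) \<subseteq> vec.span (rows Y)"
    using matrix_vector_mult_in_columnspace_gen[of "transpose Y"] by auto
qed

lemma span_rows_mult_subset: "vec.span (rows (X ** Y)) \<subseteq> vec.span (rows Y)"
  for Y :: "'a::field ^ 'n ^ 'm"
  by (auto simp: span_rows_eq simp flip: vector_matrix_mul_assoc)

lemma rank_mult_le: "rank (X ** Y) \<le> rank Y"
  for Y :: "'a::field ^ 'n ^ 'm"
  unfolding row_rank_def_gen
  by (metis span_rows_mult_subset vec.dim_span vec.dim_subset)

text \<open>Equal ranks force the row space of \<open>X ** Y\<close> to fill that of
  \<open>Y\<close>, so every row of \<open>Y\<close> combines rows of \<open>X ** Y\<close>; the
  coefficient vectors are the rows of \<open>V\<close>.\<close>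

lemma rank_mult_eq_imp_factor:
  fixes X :: "'a::field ^ 'm ^ 'p" and Y :: "'a ^ 'n ^ 'm"
  assumes "rank (X ** Y) = rank Y"
  shows "\<exists>V. Y = V ** (X ** Y)"
proof -
  have "vec.span (rows (X ** Y)) = vec.span (rows Y)"
    using assms span_rows_mult_subset[of X Y] unfolding row_rank_def_gen
    by (intro vec.subspace_dim_equal) auto
  moreover have "row i Y \<in> vec.span (rows Y)" for i
    by (auto intro: vec.span_base simp: rows_def)
  ultimately have "\<exists>v. row i Y = v v* (X ** Y)" for i
    by (auto simp: span_rows_eq)
  then obtain v where v: "\<And>i. row i Y = v i v* (X ** Y)"
    by metis
  have "row i Y = row i ((\<chi> i. v i) ** (X ** Y))" for i
  proof -
    have "row i ((\<chi> i. v i) :: 'a ^ 'p ^ 'm) = v i"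
      by (simp add: row_def)
    then show ?thesis
      by (simp add: row_matrix_mult v)
  qed
  then have "Y = (\<chi> i. v i) ** (X ** Y)"
    by (simp add: row_def vec_eq_iff)
  then show ?thesis ..
qed

subsection \<open>The Drazin inverse\<close>

text \<open>The ranks of the powers form a non-increasing sequence of naturals, which cannot
  decrease strictly forever, so the \<open>LEAST\<close> in \<open>ind\<close> is attained.\<close>

lemma rank_power_eq_ind: "rank (X ^\<^sub>m ind X) = rank (X ^\<^sub>m (ind X + 1))"
proof -
  define f where "f k = rank (X ^\<^sub>m k)" for k
  have le: "f (k + 1) \<le> f k" for k
    by (simp add: f_def rank_mult_le)
  have "\<exists>k. f k = f (k + 1)"
  proof (rule ccontr)
    assume "\<nexists>k. f k = f (k + 1)"
    then have less: "f (k + 1) < f k" for k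
      using le[of k] by (metis le_neq_implies_less)
    have "f k + k \<le> f 0" for k
    proof (induction k)
      case (Suc k)
      then show ?case
        using less[of k] by simp
    qed simp
    from this[of "Suc (f 0)"] show False
      by simp
  qed
  then show ?thesis
    unfolding ind_def f_def by (rule LeastI_ex)
qed

section \<open>One-sided factorizations of powers\<close>

lemma power_ind_left_factor: "\<exists>V. X ^\<^sub>m ind X = V ** (X ^\<^sub>m Suc (ind X))"
  using rank_mult_eq_imp_factor[of X "X ^\<^sub>m ind X"] rank_power_eq_ind[of X] by simp

text \<open>Multiplied on the right by \<open>X ^\<^sub>m j\<close>, the hypothesis can be
  substituted again at the exponent \<open>k + j\<close>; every substitution adds one factor
  \<open>V\<close>.\<close>

lemma power_left_factor_iterate:
  assumes "X ^\<^sub>m k = V ** (X ^\<^sub>m Suc k)"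
  shows "X ^\<^sub>m k = (V ^\<^sub>m j) ** (X ^\<^sub>m (k + j))"
proof (induction j)
  case (Suc j)
  have "X ^\<^sub>m (k + j) = V ** (X ^\<^sub>m Suc (k + j))"
    using assms by (simp add: matrix_power_add matrix_mul_assoc)
  with Suc have "X ^\<^sub>m k = (V ^\<^sub>m j) ** (V ** (X ^\<^sub>m Suc (k + j)))"
    by metis
  then show ?case
    by (simp only: matrix_power_Suc_right[of V] matrix_mul_assoc add_Suc_right)
qed simp

lemma power_right_factor_iterate:
  assumes "X ^\<^sub>m k = (X ^\<^sub>m Suc k) ** W"
  shows "X ^\<^sub>m k = (X ^\<^sub>m (k + j)) ** (W ^\<^sub>m j)"
proof (induction j)
  case (Suc j)
  have "X ^\<^sub>m (k + j) = X ^\<^sub>m (j + k)"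
    by (simp add: add.commute)
  also have "\<dots> = (X ^\<^sub>m (j + Suc k)) ** W"
    using assms by (simp only: matrix_power_add matrix_mul_assoc)
  finally have "X ^\<^sub>m (k + j) = (X ^\<^sub>m Suc (k + j)) ** W"
    by (simp add: add.commute)
  with Suc have "X ^\<^sub>m k = (X ^\<^sub>m Suc (k + j)) ** W ** (W ^\<^sub>m j)"
    by metis
  then show ?case
    by (simp add: matrix_mul_assoc)
qed simp

text \<open>Left and right factorizations are both extracted from equality of row ranks, applied to
  the matrix and to its transpose, so the equality of row and column rank is not needed.\<close>

lemma power_factors:
  fixes X :: "complex ^ 'n ^ 'n"
  shows "\<exists>k V W. X ^\<^sub>m k = V ** (X ^\<^sub>m Suc k) \<and> X ^\<^sub>m k = (X ^\<^sub>m Suc k) ** W"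
proof -
  define i where "i = ind X"
  define j where "j = ind (transpose X)"
  obtain V where V: "X ^\<^sub>m i = V ** (X ^\<^sub>m Suc i)"
    using power_ind_left_factor i_def by blast
  obtain W where "transpose X ^\<^sub>m j = W ** (transpose X ^\<^sub>m Suc j)"
    using power_ind_left_factor j_def by blast
  then have "transpose (transpose X ^\<^sub>m j) = transpose (W ** (transpose X ^\<^sub>m Suc j))"
    by simp
  then have W: "X ^\<^sub>m j = (X ^\<^sub>m Suc j) ** transpose W"
    by (simp only: matrix_transpose_mul transpose_matrix_power transpose_transpose)
  \<comment> \<open>Each factorization survives multiplication by further powers of
    \<open>X\<close>, so the exponent \<open>i + j\<close> serves both.\<close>
  have "X ^\<^sub>m (i + j) = V ** (X ^\<^sub>m Suc (i + j))"
    using V by (simp add: matrix_power_add matrix_mul_assoc)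
  moreover have "X ^\<^sub>m (i + j) = (X ^\<^sub>m Suc (i + j)) ** transpose W"
  proof -
    have "X ^\<^sub>m (i + j) = (X ^\<^sub>m (i + Suc j)) ** transpose W"
      using W by (simp only: matrix_power_add matrix_mul_assoc)
    then show ?thesis
      by simp
  qed
  ultimately show ?thesis
    by blast
qed

text \<open>The candidate \<open>(X ^\<^sub>m k) ** (W ^\<^sub>m Suc k)\<close> also equals
  \<open>(V ^\<^sub>m Suc k) ** (X ^\<^sub>m k)\<close>, and having both forms makes it commute with
  \<open>X\<close>.\<close>

lemma drazin_equations_exist:
  fixes X :: "complex ^ 'n ^ 'n"
  shows "\<exists>k Y. X ** Y = Y ** X \<and> Y ** X ** Y = Y \<and> X ^\<^sub>m k = (X ^\<^sub>m Suc k) ** Y"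
proof -
  obtain k V W where V: "X ^\<^sub>m k = V ** (X ^\<^sub>m Suc k)" and W: "X ^\<^sub>m k = (X ^\<^sub>m Suc k) ** W"
    using power_factors by blast
  note Vj = power_left_factor_iterate[OF V] and Wj = power_right_factor_iterate[OF W]
  define Y where "Y = (X ^\<^sub>m k) ** (W ^\<^sub>m Suc k)"
  \<comment> \<open>Both sides are
    \<open>(V ^\<^sub>m j) ** (X ^\<^sub>m (k + j)) ** (W ^\<^sub>m j)\<close>, bracketed in the two
    possible ways.\<close>
  have mid: "(V ^\<^sub>m j) ** (X ^\<^sub>m k) = (X ^\<^sub>m k) ** (W ^\<^sub>m j)" for j
  proof -
    have "(V ^\<^sub>m j) ** (X ^\<^sub>m k) = (V ^\<^sub>m j) ** ((X ^\<^sub>m (k + j)) ** (W ^\<^sub>m j))"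
      by (simp only: Wj[symmetric])
    also have "\<dots> = (X ^\<^sub>m k) ** (W ^\<^sub>m j)"
      by (simp only: matrix_mul_assoc Vj[symmetric])
    finally show ?thesis .
  qed
  have XY: "X ** Y = (X ^\<^sub>m k) ** (W ^\<^sub>m k)"
  proof -
    have "X ** Y = (X ^\<^sub>m Suc k) ** W ** (W ^\<^sub>m k)"
      by (simp add: Y_def matrix_mul_assoc)
    then show ?thesis
      by (simp only: W[symmetric])
  qed
  have YX: "Y ** X = (X ^\<^sub>m k) ** (W ^\<^sub>m k)"
  proof -
    have "Y ** X = (V ^\<^sub>m Suc k) ** (X ^\<^sub>m k) ** X"
      by (simp only: Y_def mid)
    also have "\<dots> = (V ^\<^sub>m k) ** (V ** (X ^\<^sub>m Suc k))"
      by (simp only: matrix_power_Suc_right matrix_mul_assoc)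
    also have "\<dots> = (X ^\<^sub>m k) ** (W ^\<^sub>m k)"
      by (simp only: V[symmetric] mid)
    finally show ?thesis .
  qed
  have idem: "(X ^\<^sub>m k) ** (W ^\<^sub>m k) ** (X ^\<^sub>m k) = X ^\<^sub>m k"
  proof -
    have "(X ^\<^sub>m k) ** (W ^\<^sub>m k) ** (X ^\<^sub>m k) = (V ^\<^sub>m k) ** (X ^\<^sub>m (k + k))"
      by (simp add: mid[symmetric] matrix_power_add matrix_mul_assoc)
    then show ?thesis
      by (simp only: Vj[symmetric])
  qed
  have "Y ** X ** Y = Y"
    unfolding YX by (simp only: Y_def matrix_mul_assoc idem)
  moreover have "X ^\<^sub>m k = (X ^\<^sub>m Suc k) ** Y"
  proof -
    have "(X ^\<^sub>m Suc k) ** Y = (X ^\<^sub>m k) ** (X ** Y)"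
      by (simp only: matrix_power_Suc_right matrix_mul_assoc)
    also have "\<dots> = (X ^\<^sub>m (k + k)) ** (W ^\<^sub>m k)"
      by (simp add: XY matrix_power_add matrix_mul_assoc)
    finally show ?thesis
      by (simp only: Wj[symmetric])
  qed
  ultimately show ?thesis
    using XY YX by metis
qed

section \<open>Uniqueness and the choice of exponent\<close>

lemma drazin_equations_lift:
  assumes "X ^\<^sub>m k = (X ^\<^sub>m Suc k) ** Y"
  shows "X ^\<^sub>m (l + k) = (X ^\<^sub>m Suc (l + k)) ** Y"
proof -
  have "X ^\<^sub>m (l + k) = (X ^\<^sub>m (l + Suc k)) ** Y"
    using assms by (simp only: matrix_power_add matrix_mul_assoc)
  then show ?thesis
    by simp
qed

text \<open>Commutation turns \<open>Y ** X ** Y = Y\<close> into \<open>X ** (Y ** Y) = Y\<close>,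
  which is inserted \<open>j\<close> times.\<close>

lemma drazin_power_expand:
  assumes "X ** Y = Y ** X" "Y ** X ** Y = Y"
  shows "Y = (X ^\<^sub>m j) ** (Y ^\<^sub>m Suc j)"
proof (induction j)
  case (Suc j)
  have "X ** (Y ** Y) = Y"
    using assms by (simp add: matrix_mul_assoc)
  then have *: "(X ** (Y ** Y)) ** (Y ^\<^sub>m j) = Y ** (Y ^\<^sub>m j)"
    by simp
  have "(X ^\<^sub>m Suc j) ** (Y ^\<^sub>m Suc (Suc j)) = (X ^\<^sub>m j) ** ((X ** (Y ** Y)) ** (Y ^\<^sub>m j))"
    by (simp only: matrix_power_Suc_right[of X] matrix_power.simps(2)[of Y] matrix_mul_assoc)
  then show ?case
    using Suc * by simp
qed simp

text \<open>At the common exponent \<open>n = k + l\<close>, writing exponents informally, Y =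
  Y^(n+1) X^n = Y^(n+1) X^(2n+1) Z^(n+1) = X^n Z^(n+1) = Z.\<close>

lemma drazin_equations_unique:
  assumes Y: "X ** Y = Y ** X" "Y ** X ** Y = Y" "X ^\<^sub>m k = (X ^\<^sub>m Suc k) ** Y"
    and Z: "X ** Z = Z ** X" "Z ** X ** Z = Z" "X ^\<^sub>m l = (X ^\<^sub>m Suc l) ** Z"
  shows "Y = Z"
proof -
  define n where "n = k + l"
  have Yn: "X ^\<^sub>m n = (X ^\<^sub>m Suc n) ** Y" and Zn: "X ^\<^sub>m n = (X ^\<^sub>m Suc n) ** Z"
    unfolding n_def using drazin_equations_lift[OF Y(3), of l] drazin_equations_lift[OF Z(3), of k]
    by (simp_all only: add.commute)
  note Yj = power_right_factor_iterate[OF Yn, of "Suc n"]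
    and Zj = power_right_factor_iterate[OF Zn, of "Suc n"]
  have comm: "(X ^\<^sub>m i) ** (Y ^\<^sub>m j) = (Y ^\<^sub>m j) ** (X ^\<^sub>m i)" for i j
    using Y(1) by (metis matrix_power_commute)
  have "Y = (Y ^\<^sub>m Suc n) ** (X ^\<^sub>m n)"
    using drazin_power_expand[OF Y(1,2), of n] comm by metis
  also have "\<dots> = (Y ^\<^sub>m Suc n) ** (X ^\<^sub>m (n + Suc n)) ** (Z ^\<^sub>m Suc n)"
    using Zj by (metis matrix_mul_assoc)
  also have "\<dots> = (X ^\<^sub>m n) ** (Z ^\<^sub>m Suc n)"
    using Yj comm by metis
  also have "\<dots> = Z"
    using drazin_power_expand[OF Z(1,2), of n] by simp
  finally show ?thesis .
qed

text \<open>A left factorization at \<open>ind X\<close> lowers the exponent in the third Drazin equation from any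
  value to \<open>ind X\<close>.\<close>

lemma drazin_equations_at_ind:
  assumes "X ^\<^sub>m k = (X ^\<^sub>m Suc k) ** Y"
  shows "X ^\<^sub>m ind X = (X ^\<^sub>m Suc (ind X)) ** Y"
proof -
  define i where "i = ind X"
  obtain V where V: "X ^\<^sub>m i = V ** (X ^\<^sub>m Suc i)"
    using power_ind_left_factor i_def by blast
  have ik: "X ^\<^sub>m (i + k) = (X ^\<^sub>m Suc (i + k)) ** Y"
    by (rule drazin_equations_lift[OF assms])
  have Vk: "X ^\<^sub>m i = (V ^\<^sub>m k) ** (X ^\<^sub>m (i + k))"
    by (rule power_left_factor_iterate[OF V])
  also have "\<dots> = (V ^\<^sub>m k) ** (X ^\<^sub>m (i + k)) ** X ** Y"
    using arg_cong[OF ik, of "\<lambda>U. (V ^\<^sub>m k) ** U"]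
    by (simp only: matrix_power_Suc_right matrix_mul_assoc)
  also have "\<dots> = (X ^\<^sub>m Suc i) ** Y"
    using Vk by (simp only: matrix_power_Suc_right)
  finally show ?thesis
    by (simp add: i_def)
qed

text \<open>The exponent \<open>k\<close> is free, so a candidate can be recognized without
  computing \<open>ind X\<close>.\<close>

lemma drazin_inverse_eqI:
  assumes "X ** Y = Y ** X" "Y ** X ** Y = Y" "X ^\<^sub>m k = (X ^\<^sub>m Suc k) ** Y"
  shows "X\<^sup>d = Y"
  unfolding drazin_inverse_def
proof (rule the_equality)
  show "is_drazin_inverse X Y"
    using assms drazin_equations_at_ind[OF assms(3)] by (simp add: is_drazin_inverse_def)
  show "Z = Y" if "is_drazin_inverse X Z" for Z
    using that drazin_equations_unique[OF _ _ _ assms, of Z "ind X"]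
    by (simp add: is_drazin_inverse_def)
qed

lemma is_drazin_inverse_drazin_inverse: "is_drazin_inverse X X\<^sup>d"
proof -
  obtain k Y where Y: "X ** Y = Y ** X" "Y ** X ** Y = Y" "X ^\<^sub>m k = (X ^\<^sub>m Suc k) ** Y"
    using drazin_equations_exist by blast
  then show ?thesis
    using drazin_inverse_eqI[OF Y] drazin_equations_at_ind[OF Y(3)]
    by (simp add: is_drazin_inverse_def)
qed

lemma drazin_commute: "X ** X\<^sup>d = X\<^sup>d ** X"
  and drazin_inner: "X\<^sup>d ** X ** X\<^sup>d = X\<^sup>d"
  and drazin_power_ind: "X ^\<^sub>m ind X = (X ^\<^sub>m Suc (ind X)) ** X\<^sup>d"
  using is_drazin_inverse_drazin_inverse[of X] by (simp_all add: is_drazin_inverse_def)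

text \<open>Exponent 1 suffices, since commutation rewrites \<open>X ** Y ** X = X\<close> as
  \<open>X = X ** X ** Y\<close>. Uniqueness of the group inverse is inherited in this way.\<close>

lemma drazin_inverse_group:
  assumes "is_group_inverse X Y"
  shows "X\<^sup>d = Y"
  using assms by (intro drazin_inverse_eqI[where k = 1])
    (auto simp: is_group_inverse_def matrix_ring_simps)

lemma group_inverse_eqI:
  assumes "is_group_inverse X Y"
  shows "X\<^sup># = Y"
  unfolding group_inverse_def
  using assms drazin_inverse_group by blast

lemma is_group_inverse_group_inverse:
  assumes "group_invertible X"
  shows "is_group_inverse X X\<^sup>#"
  using assms group_inverse_eqI by (auto simp: group_invertible_def)

subsection \<open>Inverses in corner rings\<close>

text \<open>Absorbing \<open>P\<close> on both sides encodes membership in the corner with identity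
  \<open>P\<close>. Idempotence of \<open>P\<close> follows:
  \<open>P ** P = P ** X ** Y = X ** Y = P\<close>.\<close>

definition corner_inverse ::
  "'a::semiring_1 ^ 'n ^ 'n \<Rightarrow> 'a ^ 'n ^ 'n \<Rightarrow> 'a ^ 'n ^ 'n \<Rightarrow> bool" where
  "corner_inverse P X Y \<longleftrightarrow>
     P ** X = X \<and> X ** P = X \<and> P ** Y = Y \<and> Y ** P = Y \<and> X ** Y = P \<and> Y ** X = P"

lemma corner_inverse_is_group_inverse: "corner_inverse P X Y \<Longrightarrow> is_group_inverse X Y"
  by (simp add: corner_inverse_def is_group_inverse_def)

lemma corner_inverse_group_invertible: "corner_inverse P X Y \<Longrightarrow> group_invertible X"
  using corner_inverse_is_group_inverse group_invertible_def by blast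

lemma corner_inverse_group_inverse: "corner_inverse P X Y \<Longrightarrow> X\<^sup># = Y"
  using corner_inverse_is_group_inverse group_inverse_eqI by blast

section \<open>Units in the corner of \<open>A\<^sup>e\<close>\<close>

lemma drazin_idem_commute: "A\<^sup>e = A\<^sup>d ** A" "A\<^sup>e ** A = A ** A\<^sup>e"
  by (simp_all add: drazin_idem_def matrix_mul_assoc drazin_commute)

lemma drazin_idem_mult_drazin: "A\<^sup>e ** A\<^sup>d = A\<^sup>d" "A\<^sup>d ** A\<^sup>e = A\<^sup>d"
  by (metis drazin_idem_commute(1) drazin_inner, metis drazin_idem_def drazin_inner matrix_mul_assoc)

lemma drazin_idem_idem: "A\<^sup>e ** A\<^sup>e = A\<^sup>e"
  by (metis drazin_idem_def drazin_idem_mult_drazin(2) matrix_mul_assoc)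

text \<open>\<open>A\<close> itself need not lie in the corner; the unit that
  \<open>A\<^sup>d\<close> inverts is its compression.\<close>

lemma corner_inverse_drazin: "corner_inverse (A\<^sup>e) (A\<^sup>e ** A) (A\<^sup>d)"
proof -
  have "A\<^sup>e ** A ** A\<^sup>d = A\<^sup>e" "A\<^sup>d ** (A\<^sup>e ** A) = A\<^sup>e"
    using drazin_idem_idem[of A]
    by (simp add: drazin_idem_def matrix_mul_assoc)
      (simp add: matrix_mul_assoc drazin_idem_mult_drazin flip: drazin_idem_commute(1))
  moreover have "A\<^sup>e ** A ** A\<^sup>e = A\<^sup>e ** A"
    by (simp add: drazin_idem_commute(2) drazin_idem_idem flip: matrix_mul_assoc)
  ultimately show ?thesis
    using drazin_idem_idem[of A] drazin_idem_mult_drazin[of A]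
    by (simp add: corner_inverse_def matrix_mul_assoc)
qed

text \<open>With respect to \<open>P\<close>, the matrix \<open>mat 1 - P + W\<close> is block upper
  triangular with diagonal blocks \<open>W ** P\<close> and an identity, so the corner block
  \<open>P ** U ** P\<close> of its inverse \<open>U\<close> inverts \<open>W ** P\<close>.\<close>

lemma corner_inverse_of_invertible:
  fixes P W :: "'a::field ^ 'n ^ 'n"
  assumes inv: "invertible (mat 1 - P + W)" and P: "P ** P = P" and W: "P ** W = W"
  shows "\<exists>Y. corner_inverse P (W ** P) Y"
proof -
  obtain U where U1: "(mat 1 - P + W) ** U = mat 1" and U2: "U ** (mat 1 - P + W) = mat 1"
    using inv unfolding invertible_def by blast
  \<comment> \<open>\<open>P\<close> annihilates \<open>mat 1 - P\<close> from both sides: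
    multiplying by \<open>P\<close> on the left leaves \<open>W\<close>, and below, on the right,
    leaves \<open>W ** P\<close>.\<close>
  have "P ** ((mat 1 - P + W) ** U) = W ** U"
    by (simp add: matrix_ring_simps P[THEN matrix_mult_collapse] W[THEN matrix_mult_collapse])
  then have WU: "W ** U = P"
    by (simp add: U1)
  have PU: "P ** U = U - mat 1 + P"
    using U1 by (simp add: matrix_ring_simps WU algebra_simps)
  have "U ** W ** P = U ** (mat 1 - P + W) ** P"
    by (simp add: matrix_ring_simps P W)
  then have UWP: "U ** (W ** P) = P"
    by (simp add: U2 matrix_mul_assoc)
  have "W ** P ** (P ** U ** P) = P"
    by (simp add: matrix_ring_simps P P[THEN matrix_mult_collapse])
      (simp add: matrix_mul_assoc[of P] PU matrix_ring_simps P
        WU[THEN matrix_mult_collapse])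
  moreover have "P ** U ** P ** (W ** P) = P"
    by (simp add: matrix_ring_simps W[THEN matrix_mult_collapse] UWP P)
  ultimately have "corner_inverse P (W ** P) (P ** U ** P)"
    unfolding corner_inverse_def
    by (simp add: matrix_ring_simps P W P[THEN matrix_mult_collapse] W[THEN matrix_mult_collapse])
  then show ?thesis ..
qed

text \<open>\<open>X = a ** (a' ** X)\<close> is a product of two units of the corner. The lemma
  serves to strip the unit \<open>a'\<close> from a product.\<close>

lemma corner_inverse_left_factor:
  assumes "corner_inverse P a a'" and "corner_inverse P (a' ** X) v" and "P ** X = X"
  shows "corner_inverse P X (v ** a')"
proof -
  note a = assms(1)[unfolded corner_inverse_def] and v = assms(2)[unfolded corner_inverse_def]
  have "X = a ** (a' ** X)"
    using a assms(3) by (simp add: matrix_mul_assoc)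
  then have "X ** (v ** a') = a ** ((a' ** X) ** v) ** a'"
    by (metis matrix_mul_assoc)
  then have "X ** (v ** a') = P"
    using a v by simp
  moreover have "X ** P = X"
    using \<open>X = a ** (a' ** X)\<close> v by (metis matrix_mul_assoc)
  moreover have "(v ** a') ** X = P" "P ** (v ** a') = v ** a'" "(v ** a') ** P = v ** a'"
    using a v by (simp_all add: matrix_mul_assoc) (simp_all flip: matrix_mul_assoc)
  ultimately show ?thesis
    using assms(3) by (simp add: corner_inverse_def)
qed

lemma corner_inverse_right_factor:
  assumes "corner_inverse P a a'" and "corner_inverse P (X ** a) v" and "X ** P = X"
  shows "corner_inverse P X (a ** v)"
proof -
  note a = assms(1)[unfolded corner_inverse_def] and v = assms(2)[unfolded corner_inverse_def]
  have X: "X = (X ** a) ** a'"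
    using a assms(3) by (simp flip: matrix_mul_assoc)
  have "(a ** v) ** X = a ** (v ** (X ** a)) ** a'"
    using X by (metis matrix_mul_assoc)
  then have "(a ** v) ** X = P"
    using a v by simp
  moreover have "P ** X = X"
    using X v by (metis matrix_mul_assoc)
  moreover have "X ** (a ** v) = P" "P ** (a ** v) = a ** v" "(a ** v) ** P = a ** v"
    using a v by (simp_all add: matrix_mul_assoc) (simp_all flip: matrix_mul_assoc)
  ultimately show ?thesis
    using assms(3) by (simp add: corner_inverse_def)
qed

lemma drazin_idem_corner:
  assumes "s = A\<^sup>e ** S ** A\<^sup>e"
  shows "A\<^sup>e ** s = s" "s ** A\<^sup>e = s"
  using drazin_idem_idem[of A]
  by (simp_all add: assms matrix_mul_assoc) (simp flip: matrix_mul_assoc)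

text \<open>For a group-invertible \<open>X\<close> the Drazin inverse is \<open>X\<^sup>#\<close>,
  so \<open>X\<^sup>e = P\<close> says exactly that \<open>X ** X\<^sup># = P\<close>.\<close>

lemma corner_inverse_of_drazin_idem:
  assumes "group_invertible X" and "X\<^sup>e = P"
  shows "corner_inverse P X (X\<^sup>#)"
proof -
  have g: "is_group_inverse X X\<^sup>#"
    by (rule is_group_inverse_group_inverse[OF assms(1)])
  then have h: "X ** X\<^sup># ** X = X" "X\<^sup># ** X ** X\<^sup># = X\<^sup>#"
    and P: "P = X ** X\<^sup>#" "P = X\<^sup># ** X"
    using assms(2) by (auto simp: is_group_inverse_def drazin_idem_def drazin_inverse_group[OF g])
  have "P ** X = X" "X\<^sup># ** P = X\<^sup>#"
    by (simp_all only: P(1) matrix_mul_assoc h)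
  moreover have "X ** P = X" "P ** X\<^sup># = X\<^sup>#"
    by (simp_all only: P(2) matrix_mul_assoc h)
  ultimately show ?thesis
    using P by (simp add: corner_inverse_def)
qed

lemma corner_inverse_of_invertible_left:
  assumes "invertible (mat 1 - A\<^sup>e + A\<^sup>d ** s)" and s: "A\<^sup>e ** s = s" "s ** A\<^sup>e = s"
  shows "\<exists>Y. corner_inverse (A\<^sup>e) s Y"
proof -
  have "A\<^sup>e ** (A\<^sup>d ** s) = A\<^sup>d ** s"
    by (simp add: matrix_mul_assoc drazin_idem_mult_drazin)
  with assms(1) have "\<exists>v. corner_inverse (A\<^sup>e) (A\<^sup>d ** s ** A\<^sup>e) v"
    by (rule corner_inverse_of_invertible[OF _ drazin_idem_idem])
  then obtain v where "corner_inverse (A\<^sup>e) (A\<^sup>d ** s) v"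
    by (auto simp: s simp flip: matrix_mul_assoc)
  then show ?thesis
    using corner_inverse_left_factor[OF corner_inverse_drazin _ s(1)] by blast
qed

text \<open>After compression the product is \<open>A\<^sup>d ** s ** (A\<^sup>e ** A)\<close> with
  \<open>s = A\<^sup>e ** S ** A\<^sup>e\<close>. Both outer factors are units of the corner and are
  stripped one after the other.\<close>

lemma corner_inverse_of_invertible_product:
  assumes "invertible (mat 1 - A\<^sup>e + A\<^sup>d ** S ** A)"
  shows "\<exists>Y. corner_inverse (A\<^sup>e) (A\<^sup>e ** S ** A\<^sup>e) Y"
proof -
  have "A\<^sup>e ** (A\<^sup>d ** S ** A) = A\<^sup>d ** S ** A"
    by (simp add: matrix_mul_assoc drazin_idem_mult_drazin)
  with assms have "\<exists>v. corner_inverse (A\<^sup>e) (A\<^sup>d ** S ** A ** A\<^sup>e) v"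
    by (rule corner_inverse_of_invertible[OF _ drazin_idem_idem])
  moreover have "A\<^sup>d ** S ** A ** A\<^sup>e = A\<^sup>d ** ((A\<^sup>e ** S ** A\<^sup>e) ** (A\<^sup>e ** A))"
  proof -
    have "A\<^sup>e ** (A\<^sup>e ** A) = A ** A\<^sup>e"
      by (simp add: matrix_mul_assoc drazin_idem_idem) (rule drazin_idem_commute(2))
    then have "A\<^sup>d ** S ** A ** A\<^sup>e = (A\<^sup>d ** A\<^sup>e) ** S ** (A\<^sup>e ** (A\<^sup>e ** A))"
      by (simp only: drazin_idem_mult_drazin(2) matrix_mul_assoc)
    then show ?thesis
      by (simp only: matrix_mul_assoc)
  qed
  ultimately obtain v
    where v: "corner_inverse (A\<^sup>e) (A\<^sup>d ** ((A\<^sup>e ** S ** A\<^sup>e) ** (A\<^sup>e ** A))) v"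
    by auto
  have "corner_inverse (A\<^sup>e) ((A\<^sup>e ** S ** A\<^sup>e) ** (A\<^sup>e ** A)) (v ** A\<^sup>d)"
    by (rule corner_inverse_left_factor[OF corner_inverse_drazin v])
      (simp add: matrix_mul_assoc drazin_idem_idem)
  then show ?thesis
    using corner_inverse_right_factor[OF corner_inverse_drazin _ drazin_idem_corner(2)[OF refl]]
    by blast
qed

text \<open>Brings the condition into the shape \<open>mat 1 - P + W\<close> treated by
  \<open>corner_inverse_of_invertible\<close>.\<close>

lemma drazin_mult_diff_eq: "mat 1 + A\<^sup>d ** (s - A) = mat 1 - A\<^sup>e + A\<^sup>d ** s"
  by (simp add: drazin_idem_commute(1) matrix_diff_ldistrib)

lemma drazin_mult_diff_mult_eq:
  "mat 1 + A\<^sup>d ** (S - mat 1) ** A = mat 1 - A\<^sup>e + A\<^sup>d ** S ** A"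
  by (simp add: drazin_idem_commute(1) matrix_diff_ldistrib matrix_diff_rdistrib)

lemma corner_inverse_drazin_cases:
  assumes s: "s = A\<^sup>e ** S ** A\<^sup>e"
    and cond: "(group_invertible s \<and> s\<^sup>e = A\<^sup>e) \<or> invertible (A\<^sup>\<pi> + s) \<or>
      invertible (mat 1 + A\<^sup>d ** (s - A)) \<or> invertible (mat 1 + A\<^sup>d ** (S - mat 1) ** A)"
  shows "\<exists>Y. corner_inverse (A\<^sup>e) s Y"
proof -
  note sP = drazin_idem_corner[OF s]
  note eqs = drazin_mult_diff_eq drazin_mult_diff_mult_eq spectral_idem_def
  show ?thesis
    using cond unfolding eqs
  proof (elim disjE)
    assume "group_invertible s \<and> s\<^sup>e = A\<^sup>e"
    then show ?thesis
      using corner_inverse_of_drazin_idem by blast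
  next
    assume "invertible (mat 1 - A\<^sup>e + s)"
    from corner_inverse_of_invertible[OF this drazin_idem_idem sP(1)] show ?thesis
      unfolding sP .
  next
    assume "invertible (mat 1 - A\<^sup>e + A\<^sup>d ** s)"
    then show ?thesis
      using sP by (rule corner_inverse_of_invertible_left)
  next
    assume "invertible (mat 1 - A\<^sup>e + A\<^sup>d ** S ** A)"
    then show ?thesis
      unfolding s by (rule corner_inverse_of_invertible_product)
  qed
qed

subsection \<open>Schur complements\<close>

text \<open>The Sherman-Morrison-Woodbury formula inside corners: invertibility passes from one
  Schur complement to the other, with an explicit inverse.\<close>

lemma corner_inverse_schur_complement:
  fixes a a' y :: "'a::ring_1 ^ 'n ^ 'n" and d d' :: "'a ^ 'm ^ 'm"
    and b :: "'a ^ 'n ^ 'm" and c :: "'a ^ 'm ^ 'n"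
  assumes a: "corner_inverse P a a'" and d: "corner_inverse Q d d'"
    and b: "Q ** b = b" "b ** P = b" and c: "P ** c = c" "c ** Q = c"
    and y: "corner_inverse P (a - c ** d' ** b) y"
  shows "corner_inverse Q (d - b ** a' ** c) (d' + d' ** b ** y ** c ** d')"
proof -
  note a = a[unfolded corner_inverse_def] and d = d[unfolded corner_inverse_def]
    and y = y[unfolded corner_inverse_def]
  have eqs: "P ** a = a" "a ** P = a" "P ** a' = a'" "a' ** P = a'" "a ** a' = P" "a' ** a = P"
    "Q ** d = d" "d ** Q = d" "Q ** d' = d'" "d' ** Q = d'" "d ** d' = Q" "d' ** d = Q"
    "P ** y = y" "y ** P = y"
    using a d y by simp_all
  note rules = eqs b c eqs[THEN matrix_mult_collapse] b[THEN matrix_mult_collapse]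
    c[THEN matrix_mult_collapse]
  \<comment> \<open>Solving \<open>(a - c ** d' ** b) ** y = P\<close> for the product term. The
    primed variants carry a right factor \<open>v\<close>, so that they also rewrite inside
    right-associated products.\<close>
  have y1: "c ** (d' ** (b ** y)) = a ** y - P"
    using y by (auto simp: matrix_ring_simps algebra_simps)
  have y1': "c ** (d' ** (b ** (y ** v))) = a ** (y ** v) - P ** v" for v :: "'a ^ 'm ^ 'n"
    using arg_cong[OF y1, of "\<lambda>u. u ** v"] by (simp add: matrix_ring_simps)
  have y2: "y ** (c ** (d' ** b)) = y ** a - P"
    using y by (auto simp: matrix_ring_simps algebra_simps)
  have y2': "y ** (c ** (d' ** (b ** v))) = y ** (a ** v) - P ** v" for v :: "'a ^ 'm ^ 'n"
    using arg_cong[OF y2, of "\<lambda>u. u ** v"] by (simp add: matrix_ring_simps)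
  have "(d - b ** a' ** c) ** (d' + d' ** b ** y ** c ** d') = Q"
    by (simp add: matrix_ring_simps rules y1')
  moreover have "(d' + d' ** b ** y ** c ** d') ** (d - b ** a' ** c) = Q"
    by (simp add: matrix_ring_simps rules y2')
  moreover have
    "Q ** (d - b ** a' ** c) = d - b ** a' ** c" "(d - b ** a' ** c) ** Q = d - b ** a' ** c"
    "Q ** (d' + d' ** b ** y ** c ** d') = d' + d' ** b ** y ** c ** d'"
    "(d' + d' ** b ** y ** c ** d') ** Q = d' + d' ** b ** y ** c ** d'"
    by (simp_all add: matrix_ring_simps rules)
  ultimately show ?thesis
    unfolding corner_inverse_def by blast
qed

section \<open>Block matrices and block elimination\<close>

lemma block_matrix_mult:
  fixes P :: "'a::semiring_1 ^ 'c ^ 'r" and Q :: "'a ^ 'd ^ 'r" and R :: "'a ^ 'c ^ 'q"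
    and T :: "'a ^ 'd ^ 'q" and P' :: "'a ^ 'k ^ 'c" and Q' :: "'a ^ 'l ^ 'c"
    and R' :: "'a ^ 'k ^ 'd" and T' :: "'a ^ 'l ^ 'd"
  shows "block_matrix P Q R T ** block_matrix P' Q' R' T' =
     block_matrix (P ** P' + Q ** R') (P ** Q' + Q ** T') (R ** P' + T ** R') (R ** Q' + T ** T')"
proof -
  have sum_split: "(\<Sum>k\<in>UNIV. f k) = (\<Sum>i\<in>UNIV. f (Inl i)) + (\<Sum>j\<in>UNIV. f (Inr j))"
    for f :: "'c + 'd \<Rightarrow> 'a"
    using sum.Plus[of UNIV UNIV f] by (simp add: UNIV_Plus_UNIV comp_def)
  show ?thesis
    by (simp add: vec_eq_iff block_matrix_def matrix_matrix_mult_def sum_split split: sum.split)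
qed

lemma block_matrix_eq_iff:
  "block_matrix P Q R T = block_matrix P' Q' R' T' \<longleftrightarrow> P = P' \<and> Q = Q' \<and> R = R' \<and> T = T'"
proof
  assume eq: "block_matrix P Q R T = block_matrix P' Q' R' T'"
  have "block_matrix P Q R T $ i $ j = block_matrix P' Q' R' T' $ i $ j" for i j
    by (simp add: eq)
  from this[of "Inl _" "Inl _"] this[of "Inl _" "Inr _"]
    this[of "Inr _" "Inl _"] this[of "Inr _" "Inr _"]
  show "P = P' \<and> Q = Q' \<and> R = R' \<and> T = T'"
    by (simp add: block_matrix_def vec_eq_iff)
qed simp

lemma block_matrix_exhaust: "\<exists>P Q R T. Y = block_matrix P Q R T"
proof -
  have "Y = block_matrix (\<chi> i j. Y $ Inl i $ Inl j) (\<chi> i j. Y $ Inl i $ Inr j)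
      (\<chi> i j. Y $ Inr i $ Inl j) (\<chi> i j. Y $ Inr i $ Inr j)"
    by (simp add: vec_eq_iff block_matrix_def split: sum.split)
  then show ?thesis
    by blast
qed

text \<open>Block elimination: the off-diagonal equations express \<open>r\<close> and
  \<open>q\<close> through \<open>p\<close>, and substitution into the upper left equations shows
  that \<open>p\<close> inverts the Schur complement.\<close>

lemma corner_inverse_block_imp_schur:
  fixes a p :: "'a::ring_1 ^ 'n ^ 'n" and d d' :: "'a ^ 'm ^ 'm"
  assumes Y: "corner_inverse (block_matrix P 0 0 Q) (block_matrix a c b d) (block_matrix p q r t)"
    and d: "corner_inverse Q d d'"
  shows "corner_inverse P (a - c ** d' ** b) p"
proof -
  note Y = Y[unfolded corner_inverse_def block_matrix_mult block_matrix_eq_iff, simplified]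
    and d = d[unfolded corner_inverse_def]
  \<comment> \<open>The lower left block of the product in one order and the upper right block in
    the other.\<close>
  have zero: "b ** p + d ** r = 0" "p ** c + q ** d = 0"
    by (simp_all only: Y)
  have "Q ** r = r" "q ** Q = q"
    by (simp_all only: Y)
  then have "d' ** (b ** p + d ** r) = d' ** b ** p + r"
    "(p ** c + q ** d) ** d' = p ** c ** d' + q"
    using d by (simp_all add: matrix_ring_simps) (simp add: matrix_mul_assoc)
  then have r: "r = - (d' ** b ** p)" and q: "q = - (p ** c ** d')"
    by (simp_all add: zero eq_neg_iff_add_eq_0 add.commute[of r] add.commute[of q])
  \<comment> \<open>The distributive law with minuend 0 moves the minus sign of \<open>r\<close> out
    of the product; the same is done for \<open>q\<close> below.\<close>
  have "(a - c ** d' ** b) ** p = a ** p + c ** r"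
    using matrix_diff_ldistrib[of c 0 "d' ** b ** p"]
    by (simp add: r matrix_diff_rdistrib matrix_mul_assoc)
  moreover have "p ** (a - c ** d' ** b) = p ** a + q ** b"
    using matrix_diff_rdistrib[of 0 "p ** c ** d'" b]
    by (simp add: q matrix_diff_ldistrib matrix_mul_assoc)
  moreover have "P ** (a - c ** d' ** b) = a - c ** d' ** b" "(a - c ** d' ** b) ** P = a - c ** d' ** b"
    using Y by (simp_all add: matrix_diff_ldistrib matrix_diff_rdistrib matrix_mul_assoc)
      (simp flip: matrix_mul_assoc)
  ultimately show ?thesis
    using Y by (simp add: corner_inverse_def)
qed

section \<open>Compression to the corners of \<open>A\<^sup>e\<close> and
  \<open>D\<^sup>e\<close>\<close>

lemma drazin_idem_compress:
  "A\<^sup>e ** (A\<^sup>e ** X) = A\<^sup>e ** X" "A\<^sup>e ** A ** A\<^sup>e = A\<^sup>e ** A"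
  by (simp add: matrix_mul_assoc drazin_idem_idem)
    (simp add: drazin_idem_commute(2) drazin_idem_idem flip: matrix_mul_assoc)

text \<open>Since \<open>D\<^sup>d\<close> absorbs \<open>D\<^sup>e\<close> on both sides,
  compressing a Schur complement gives the Schur complement of the compressed blocks, to which the
  corner lemmas apply.\<close>

lemma compressed_schur_complement:
  fixes A :: "complex ^ 'n ^ 'n" and D :: "complex ^ 'm ^ 'm"
    and B :: "complex ^ 'n ^ 'm" and C :: "complex ^ 'm ^ 'n"
  shows "A\<^sup>e ** (A - C ** D\<^sup>d ** B) ** A\<^sup>e =
    A\<^sup>e ** A - (A\<^sup>e ** C ** D\<^sup>e) ** D\<^sup>d ** (D\<^sup>e ** B ** A\<^sup>e)"
proof -
  have "A\<^sup>e ** (A ** A\<^sup>e) = A\<^sup>e ** A"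
    by (simp only: drazin_idem_compress(2) matrix_mul_assoc)
  moreover have "D\<^sup>e ** (D\<^sup>d ** (D\<^sup>e ** V)) = D\<^sup>d ** V" for V :: "complex ^ 'n ^ 'm"
    by (simp add: matrix_mul_assoc drazin_idem_mult_drazin)
  ultimately show ?thesis
    by (simp add: matrix_ring_simps)
qed

lemma corner_inverse_compressed_schur_complement:
  fixes A :: "complex ^ 'n ^ 'n" and D :: "complex ^ 'm ^ 'm"
    and B :: "complex ^ 'n ^ 'm" and C :: "complex ^ 'm ^ 'n"
  assumes w: "corner_inverse (D\<^sup>e) (D\<^sup>e ** (D - B ** A\<^sup>d ** C) ** D\<^sup>e) w"
  shows "corner_inverse (A\<^sup>e) (A\<^sup>e ** (A - C ** D\<^sup>d ** B) ** A\<^sup>e)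
    (A\<^sup>d + A\<^sup>d ** C ** w ** B ** A\<^sup>d)"
proof -
  let ?b = "D\<^sup>e ** B ** A\<^sup>e" and ?c = "A\<^sup>e ** C ** D\<^sup>e"
  \<comment> \<open>The compressing idempotents are absorbed by \<open>A\<^sup>d\<close> and
    \<open>w\<close>, so the inverse can be written with the original \<open>B\<close> and
    \<open>C\<close>.\<close>
  have "A\<^sup>d ** ?c ** w ** ?b ** A\<^sup>d = (A\<^sup>d ** A\<^sup>e) ** C ** (D\<^sup>e ** w ** D\<^sup>e) ** B ** (A\<^sup>e ** A\<^sup>d)"
    by (simp only: matrix_mul_assoc)
  also have "\<dots> = A\<^sup>d ** C ** w ** B ** A\<^sup>d"
    using w by (simp add: corner_inverse_def drazin_idem_mult_drazin)
  finally have "A\<^sup>d ** ?c ** w ** ?b ** A\<^sup>d = A\<^sup>d ** C ** w ** B ** A\<^sup>d" .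
  moreover have "A\<^sup>e ** ?c = ?c" "?b ** A\<^sup>e = ?b" "D\<^sup>e ** ?b = ?b" "?c ** D\<^sup>e = ?c"
    by (simp_all only: drazin_idem_compress drazin_idem_idem flip: matrix_mul_assoc)
  ultimately show ?thesis
    using corner_inverse_schur_complement[OF corner_inverse_drazin corner_inverse_drazin _ _ _ _
        w[unfolded compressed_schur_complement]]
    by (simp only: compressed_schur_complement)
qed

lemma corner_inverse_compressed_block:
  assumes "corner_inverse (block_matrix (A\<^sup>e) 0 0 (D\<^sup>e))
    (block_matrix (A\<^sup>e) 0 0 (D\<^sup>e) ** block_matrix A C B D ** block_matrix (A\<^sup>e) 0 0 (D\<^sup>e)) Y"
  shows "\<exists>y. corner_inverse (A\<^sup>e) (A\<^sup>e ** (A - C ** D\<^sup>d ** B) ** A\<^sup>e) y"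
proof -
  obtain p q r t where Y: "Y = block_matrix p q r t"
    using block_matrix_exhaust by blast
  have "block_matrix (A\<^sup>e) 0 0 (D\<^sup>e) ** block_matrix A C B D ** block_matrix (A\<^sup>e) 0 0 (D\<^sup>e) =
      block_matrix (A\<^sup>e ** A) (A\<^sup>e ** C ** D\<^sup>e) (D\<^sup>e ** B ** A\<^sup>e) (D\<^sup>e ** D)"
    by (simp add: block_matrix_mult drazin_idem_compress(2))
  then show ?thesis
    using corner_inverse_block_imp_schur[OF _ corner_inverse_drazin] assms
    unfolding Y compressed_schur_complement by metis
qed

text \<open>Inserting \<open>eq2\<close> into \<open>eq1\<close> eliminates \<open>w\<close>. Right
  multiplication by \<open>A ** A\<^sup>e\<close> then yields
  \<open>g ** S ** A\<^sup>e = A\<^sup>e\<close>, that is,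
  \<open>g ** s = A\<^sup>e\<close>.\<close>

lemma corner_inverse_of_group_inverse_identities:
  assumes S: "S = A - C ** D\<^sup>d ** B" and s: "s = A\<^sup>e ** S ** A\<^sup>e"
    and g: "is_group_inverse s g"
    and eq1: "g = A\<^sup>d ** C ** w ** B ** A\<^sup>d + A\<^sup>d" and eq2: "A\<^sup>d ** C ** w = g ** C ** D\<^sup>d"
  shows "corner_inverse (A\<^sup>e) s g"
proof -
  note sP = drazin_idem_corner[OF s]
  have g': "g ** s ** g = g" "s ** g = g ** s" "s ** g ** s = s"
    using g by (auto simp: is_group_inverse_def)
  \<comment> \<open>\<open>g = s ** g ** g = g ** g ** s\<close>, so \<open>g\<close> absorbs what
    \<open>s\<close> absorbs.\<close>
  have gP: "A\<^sup>e ** g = g" "g ** A\<^sup>e = g"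
    by (metis g'(1,2) sP(1) matrix_mul_assoc, metis g'(1,2) sP(2) matrix_mul_assoc)
  have dP: "A\<^sup>d ** (A ** A\<^sup>e) = A\<^sup>e"
    by (metis drazin_idem_commute(1) drazin_idem_idem matrix_mul_assoc)
  have "g = g ** C ** D\<^sup>d ** B ** A\<^sup>d + A\<^sup>d"
    using eq1 eq2 by simp
  then have "g ** (A ** A\<^sup>e) = (g ** C ** D\<^sup>d ** B ** A\<^sup>d + A\<^sup>d) ** (A ** A\<^sup>e)"
    by simp
  then have "g ** (A ** A\<^sup>e) = g ** C ** D\<^sup>d ** B ** A\<^sup>e + A\<^sup>e"
    by (simp add: matrix_ring_simps dP)
  then have "g ** S ** A\<^sup>e = A\<^sup>e"
    by (simp add: S matrix_ring_simps)
  then have "g ** s = A\<^sup>e"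
    by (simp add: s matrix_mul_assoc gP)
  then show ?thesis
    using g' gP sP by (simp add: corner_inverse_def)
qed

subsection \<open>Block triangular matrices\<close>

text \<open>This is nilpotency of \<open>A\<close> on the range of \<open>A\<^sup>\<pi>\<close>; it
  makes the sum for \<open>S\<^sup>d\<close> finite.\<close>

lemma drazin_idem_complement_power: "(A ^\<^sub>m ind A) ** A\<^sup>\<pi> = 0"
  using drazin_power_ind[of A]
  by (simp add: matrix_power_Suc_right matrix_diff_ldistrib spectral_idem_def drazin_idem_def
      matrix_mul_assoc del: matrix_power.simps)

lemma drazin_inverse_triangular:
  fixes A S :: "complex ^ 'n ^ 'n"
  assumes s: "s = A\<^sup>e ** S ** A\<^sup>e" and g: "corner_inverse (A\<^sup>e) s g"
    and pi: "A\<^sup>\<pi> ** S = A\<^sup>\<pi> ** A"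
  shows "S\<^sup>d = g + (\<Sum>i<ind A. (g ^\<^sub>m (i + 2)) ** S ** (A ^\<^sub>m i) ** A\<^sup>\<pi>)"
proof -
  define P where "P = A\<^sup>e"
  define R where "R = A\<^sup>\<pi>"
  define k where "k = ind A"
  \<comment> \<open>\<open>f i\<close> is a term of the claimed sum, and \<open>h i\<close> is the
    same term with one factor \<open>g\<close> fewer. Left multiplication by \<open>s\<close> takes
    \<open>f i\<close> to \<open>h i\<close>, right multiplication by \<open>S\<close> takes it to
    \<open>h (Suc i)\<close>.\<close>
  define f where "f i = (g ^\<^sub>m (i + 2)) ** S ** (A ^\<^sub>m i) ** R" for i
  define h where "h i = (g ^\<^sub>m Suc i) ** S ** (A ^\<^sub>m i) ** R" for i
  define Y where "Y = g + (\<Sum>i<k. f i)"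
  define T where "T = (\<Sum>i<k. h i)"
  note idem = drazin_idem_idem[of A, folded P_def]
  have R: "R = mat 1 - P"
    by (simp add: R_def P_def spectral_idem_def)
  have RP: "R ** P = 0"
    by (simp add: R matrix_diff_rdistrib idem)
  have RA: "R ** A = A ** R"
    by (simp add: R P_def matrix_diff_rdistrib matrix_diff_ldistrib drazin_idem_commute(2))
  have RS: "R ** S = A ** R"
    using pi RA by (simp add: R_def)
  have g': "P ** s = s" "s ** P = s" "P ** g = g" "g ** P = g" "s ** g = P" "g ** s = P"
    using g by (auto simp: corner_inverse_def P_def)
  \<comment> \<open>The lower left block of \<open>S\<close> vanishes, because
    \<open>R ** S = A ** R\<close> and \<open>R ** P = 0\<close>; hence
    \<open>S ** P = P ** S ** P = s\<close>.\<close>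
  have "R ** S ** P = 0"
    unfolding RS by (simp add: RP flip: matrix_mul_assoc)
  then have SP: "S ** P = s"
    by (simp add: s R P_def[symmetric] matrix_diff_rdistrib)
  have Pf: "P ** f i = f i" and Ph: "P ** h i = h i" and sf: "s ** f i = h i" and gh: "g ** h i = f i"
    for i
    by (simp_all add: f_def h_def matrix_mul_assoc g')
  have fP: "f i ** P = 0" and hP: "h i ** P = 0" for i
    by (simp_all add: f_def h_def RP flip: matrix_mul_assoc)
  have fS: "f i ** S = h (Suc i)" for i
  proof -
    have "(A ^\<^sub>m i) ** (R ** S) = (A ^\<^sub>m Suc i) ** R"
      unfolding RS matrix_power_Suc_right by (simp add: matrix_mul_assoc)
    then show ?thesis
      by (simp add: f_def h_def) (simp flip: matrix_mul_assoc)
  qed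
  have hk: "h k = 0"
    using drazin_idem_complement_power[of A, folded R_def k_def]
    by (simp add: h_def flip: matrix_mul_assoc)
  have PY: "P ** Y = Y"
    by (simp add: Y_def matrix_add_ldistrib matrix_sum_ldistrib g' Pf)
  have TP: "T ** P = 0"
    by (simp add: T_def matrix_sum_rdistrib hP)
  have SY: "S ** Y = P + T"
  proof -
    have "S ** Y = s ** Y"
      by (metis PY SP matrix_mul_assoc)
    then show ?thesis
      by (simp add: Y_def T_def matrix_add_ldistrib matrix_sum_ldistrib g' sf)
  qed
  \<comment> \<open>Splitting by \<open>mat 1 = P + R\<close> gives \<open>g ** S = P + h 0\<close>.
    The other terms are shifted by one, and the extra last term \<open>h k\<close> is zero, so the
    result agrees with \<open>S ** Y\<close>.\<close>
  have YS: "Y ** S = P + T"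
  proof -
    have "g ** S ** P = P"
      by (simp add: SP g' flip: matrix_mul_assoc)
    then have "g ** S = P + h 0"
      by (simp add: h_def R matrix_diff_ldistrib)
    moreover have "h 0 + (\<Sum>i<k. h (Suc i)) = T"
      using sum.lessThan_Suc_shift[of h k] by (simp add: T_def hk)
    ultimately show ?thesis
      by (simp add: Y_def matrix_add_rdistrib matrix_sum_rdistrib fS add.assoc)
  qed
  \<comment> \<open>\<open>Y\<close> acts on the range of \<open>P\<close> as \<open>g\<close>, so
    it sends \<open>P\<close> to \<open>g\<close> and each \<open>h i\<close> back to
    \<open>f i\<close>.\<close>
  have YSY: "Y ** S ** Y = Y"
  proof -
    have "Y ** P = g"
      by (simp add: Y_def matrix_add_rdistrib matrix_sum_rdistrib g' fP)
    moreover from this have "Y ** h i = f i" for i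
      by (metis Ph gh matrix_mul_assoc)
    ultimately have "Y ** (P + T) = Y"
      by (simp add: T_def matrix_add_ldistrib matrix_sum_ldistrib) (simp add: Y_def)
    then show ?thesis
      by (simp add: SY flip: matrix_mul_assoc)
  qed
  \<comment> \<open>At \<open>j = k\<close> this gives \<open>R ** (S ^\<^sub>m k) = 0\<close>, so
    \<open>S ^\<^sub>m k\<close> absorbs \<open>P\<close> on the left.\<close>
  have RSj: "R ** (S ^\<^sub>m j) = (A ^\<^sub>m j) ** R" for j
  proof (induction j)
    case (Suc j)
    have "R ** (S ^\<^sub>m Suc j) = A ** (R ** (S ^\<^sub>m j))"
      by (simp add: matrix_mul_assoc RS)
    with Suc show ?case
      by (simp add: matrix_mul_assoc)
  qed simp
  have "R ** (S ^\<^sub>m k) = 0"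
    using drazin_idem_complement_power[of A, folded R_def k_def] by (simp add: RSj)
  then have PSk: "P ** (S ^\<^sub>m k) = S ^\<^sub>m k"
    by (simp add: R matrix_diff_rdistrib)
  \<comment> \<open>The third Drazin equation is checked at the exponent \<open>ind A\<close>.
    Commuting \<open>P + T\<close> to the left and inserting \<open>P\<close> removes
    \<open>T\<close>, because \<open>T ** P = 0\<close>.\<close>
  have "(S ^\<^sub>m Suc k) ** Y = (S ^\<^sub>m k) ** (P + T)"
    unfolding matrix_power_Suc_right by (simp add: SY flip: matrix_mul_assoc)
  also have "\<dots> = (P + T) ** (S ^\<^sub>m k)"
    using YS SY by (intro matrix_power_commute[symmetric]) (metis matrix_mul_assoc)
  also have "\<dots> = (P + T) ** P ** (S ^\<^sub>m k)"
    by (simp add: PSk flip: matrix_mul_assoc)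
  also have "\<dots> = S ^\<^sub>m k"
    by (simp add: matrix_add_rdistrib idem TP PSk)
  finally have "S ^\<^sub>m k = (S ^\<^sub>m Suc k) ** Y" ..
  with SY YS YSY have "S\<^sup>d = Y"
    by (intro drazin_inverse_eqI) auto
  then show ?thesis
    by (simp add: Y_def f_def R_def k_def)
qed

theorem theorem3p2:
  fixes A :: "complex ^ 'n ^ 'n" and B :: "complex ^ 'n ^ 'm"
    and C :: "complex ^ 'm ^ 'n" and D :: "complex ^ 'm ^ 'm"
    and S s :: "complex ^ 'n ^ 'n" and Z z :: "complex ^ 'm ^ 'm"
    and M E M_E :: "complex ^ ('n + 'm) ^ ('n + 'm)"
  assumes S: "S = A - C ** D\<^sup>d ** B"
    and s: "s = A\<^sup>e ** S ** A\<^sup>e"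
    and Z: "Z = D - B ** A\<^sup>d ** C"
    and z: "z = D\<^sup>e ** Z ** D\<^sup>e"
    and M: "M = block_matrix A C B D"
    and E: "E = block_matrix (A\<^sup>e) 0 0 (D\<^sup>e)"
    and M_E: "M_E = E ** M ** E"
    and conditions:
      "(group_invertible M_E \<and> M_E\<^sup>e = E)
     \<or> (group_invertible s \<and> s\<^sup>e = A\<^sup>e)
     \<or> (group_invertible z \<and> z\<^sup>e = D\<^sup>e)
     \<or> invertible (A\<^sup>\<pi> + s)
     \<or> (invertible (mat 1 + A\<^sup>d ** (s - A)) \<or> invertible (mat 1 + A\<^sup>d ** (S - mat 1) ** A))
     \<or> (invertible (mat 1 + A\<^sup>d ** (s - A)) \<and>
          s\<^sup>d = matrix_inv (mat 1 + A\<^sup>d ** (s - A)) ** A\<^sup>d)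
     \<or> invertible (D\<^sup>\<pi> + z)
     \<or> (invertible (mat 1 + D\<^sup>d ** (z - D)) \<or> invertible (mat 1 + D\<^sup>d ** (Z - mat 1) ** D))
     \<or> (invertible (mat 1 + D\<^sup>d ** (z - D)) \<and>
          z\<^sup>d = matrix_inv (mat 1 + D\<^sup>d ** (z - D)) ** D\<^sup>d)
     \<or> (group_invertible s \<and> group_invertible z \<and>
          s\<^sup># = A\<^sup>d ** C ** z\<^sup># ** B ** A\<^sup>d + A\<^sup>d \<and>
          A\<^sup>d ** C ** z\<^sup># = s\<^sup># ** C ** D\<^sup>d)
     \<or> (group_invertible s \<and> group_invertible z \<and>
          z\<^sup># = D\<^sup>d ** B ** s\<^sup># ** C ** D\<^sup>d + D\<^sup>d \<and>
          D\<^sup>d ** B ** s\<^sup># = z\<^sup># ** B ** A\<^sup>d)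
     \<or> (group_invertible M_E \<and> group_invertible s \<and> group_invertible z \<and>
          M_E\<^sup># = block_matrix
                    (A\<^sup>d + A\<^sup>d ** C ** z\<^sup># ** B ** A\<^sup>d) (- (A\<^sup>d ** C ** z\<^sup>#))
                    (- (z\<^sup># ** B ** A\<^sup>d))               (z\<^sup>#) \<and>
          M_E\<^sup># = block_matrix
                    (s\<^sup>#)                    (- (s\<^sup># ** C ** D\<^sup>d))
                    (- (D\<^sup>d ** B ** s\<^sup>#))  (D\<^sup>d ** B ** s\<^sup># ** C ** D\<^sup>d + D\<^sup>d))"
    and A_pi: "A\<^sup>\<pi> ** C ** D\<^sup>d ** B = 0"
  shows "group_invertible s \<and> group_invertible z \<and>
         s\<^sup># = A\<^sup>d ** C ** z\<^sup># ** B ** A\<^sup>d + A\<^sup>d \<and>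
         S\<^sup>d = s\<^sup># + (\<Sum>i<ind A. (s\<^sup># ^\<^sub>m (i + 2)) ** S ** (A ^\<^sub>m i) ** A\<^sup>\<pi>)"
proof -
  note s' = s[unfolded S] and z' = z[unfolded Z]
  \<comment> \<open>The second instance exchanges \<open>A\<close> with \<open>D\<close> and
    \<open>B\<close> with \<open>C\<close>, so invertibility passes between the corners in both
    directions.\<close>
  note z_imp_s = corner_inverse_compressed_schur_complement[of D B A C, folded s' z']
    and s_imp_z = corner_inverse_compressed_schur_complement[of A C D B, folded s' z']
  note identities = corner_inverse_of_group_inverse_identities
  have z_imp_ex_s: "\<exists>y. corner_inverse (A\<^sup>e) s y" if "\<exists>w. corner_inverse (D\<^sup>e) z w"
    using that z_imp_s by blast
  have "\<exists>y. corner_inverse (A\<^sup>e) s y"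
    using conditions
  proof (elim disjE)
    assume "group_invertible M_E \<and> M_E\<^sup>e = E"
    then have "corner_inverse E M_E (M_E\<^sup>#)"
      using corner_inverse_of_drazin_idem by blast
    then show ?thesis
      unfolding s' M_E M E by (rule corner_inverse_compressed_block)
  next
    assume "group_invertible s \<and> group_invertible z \<and>
          s\<^sup># = A\<^sup>d ** C ** z\<^sup># ** B ** A\<^sup>d + A\<^sup>d \<and>
          A\<^sup>d ** C ** z\<^sup># = s\<^sup># ** C ** D\<^sup>d"
    then show ?thesis
      using identities[OF S s is_group_inverse_group_inverse] by blast
  next
    assume "group_invertible s \<and> group_invertible z \<and>
          z\<^sup># = D\<^sup>d ** B ** s\<^sup># ** C ** D\<^sup>d + D\<^sup>d \<and>
          D\<^sup>d ** B ** s\<^sup># = z\<^sup># ** B ** A\<^sup>d"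
    then show ?thesis
      using identities[OF Z z is_group_inverse_group_inverse] z_imp_s by blast
  next
    assume *: "group_invertible M_E \<and> group_invertible s \<and> group_invertible z \<and>
          M_E\<^sup># = block_matrix
                    (A\<^sup>d + A\<^sup>d ** C ** z\<^sup># ** B ** A\<^sup>d) (- (A\<^sup>d ** C ** z\<^sup>#))
                    (- (z\<^sup># ** B ** A\<^sup>d))               (z\<^sup>#) \<and>
          M_E\<^sup># = block_matrix
                    (s\<^sup>#)                    (- (s\<^sup># ** C ** D\<^sup>d))
                    (- (D\<^sup>d ** B ** s\<^sup>#))  (D\<^sup>d ** B ** s\<^sup># ** C ** D\<^sup>d + D\<^sup>d)"
    \<comment> \<open>Comparing the upper blocks of the two representations of
      \<open>M_E\<^sup>#\<close> gives the two identities used in the case of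
      \<open>s\<^sup>#\<close>.\<close>
    then have "s\<^sup># = A\<^sup>d ** C ** z\<^sup># ** B ** A\<^sup>d + A\<^sup>d" "A\<^sup>d ** C ** z\<^sup># = s\<^sup># ** C ** D\<^sup>d"
      by (auto simp: block_matrix_eq_iff add.commute)
    with * show ?thesis
      using identities[OF S s is_group_inverse_group_inverse] by blast
  \<comment> \<open>The remaining cases concern \<open>s\<close> or \<open>z\<close> alone. Those
    with a formula for \<open>s\<^sup>d\<close> or \<open>z\<^sup>d\<close> enter through the
    ordinary inverse they assert, and those on \<open>z\<close> are carried to the corner of
    \<open>A\<^sup>e\<close>.\<close>
  qed (use corner_inverse_drazin_cases[OF s] z_imp_ex_s[OF corner_inverse_drazin_cases[OF z]]
      in blast)+
  then obtain w where w: "corner_inverse (D\<^sup>e) z w"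
    using s_imp_z by blast
  note g = z_imp_s[OF w]
  have z_inverse: "z\<^sup># = w"
    by (rule corner_inverse_group_inverse[OF w])
  have s_inverse: "s\<^sup># = A\<^sup>d + A\<^sup>d ** C ** w ** B ** A\<^sup>d"
    by (rule corner_inverse_group_inverse[OF g])
  \<comment> \<open>\<open>A\<^sup>\<pi>\<close> annihilates the correction term
    \<open>C ** D\<^sup>d ** B\<close> of \<open>S\<close>.\<close>
  have "A\<^sup>\<pi> ** S = A\<^sup>\<pi> ** A"
    using A_pi by (simp add: S matrix_diff_ldistrib matrix_mul_assoc)
  then have "S\<^sup>d = s\<^sup># + (\<Sum>i<ind A. (s\<^sup># ^\<^sub>m (i + 2)) ** S ** (A ^\<^sub>m i) ** A\<^sup>\<pi>)"
    unfolding s_inverse by (rule drazin_inverse_triangular[OF s g])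
  moreover have "group_invertible s" "group_invertible z"
    using corner_inverse_group_invertible w g by blast+
  moreover have "s\<^sup># = A\<^sup>d ** C ** z\<^sup># ** B ** A\<^sup>d + A\<^sup>d"
    by (simp add: z_inverse s_inverse)
  ultimately show ?thesis
    by blast
qed

end
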